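(* Let $X$ be a complex Banach space and let $T$ be an invertible operator on $X$. Suppose that $T$ is structurally stable or structurally stable relative to $GL(X)$. Then the following facts hold: (a) If $T$ is expansive, then $T$ is uniformly expansive. (b) If $T$ is positively expansive, then $T$ is hyperbolic.
   Context: An operator on a Banach space $X$ is a bounded linear map $T:X\to X$; $GL(X)$ is the group of all invertible operators on $X$ (bijective, with bounded inverse). $S_X$ is the unit sphere of $X$, $\mathbb{N}$ is the set of positive integers. Two maps $\varphi,\psi:X\to X$ are topologically conjugate if there is a homeomorphism $h:X\to X$ such that $h\circ\varphi=\psi\circ h$. $C_b(X)$ is the Banach space of all bounded continuous maps $\varphi:X\to X$ with norm $\|\varphi\|_\infty=\sup_{x\in X}\|\varphi(x)\|$. A map $\varphi:X\to X$ is Lipschitz if $\operatorname{Lip}(\varphi)=\sup_{x\ne y}\frac{\|\varphi(x)-\varphi(y)\|}{\|x-y\|}$ is finite. An invertible operator $T$ on $X$ is structurally stable if there exists $\varepsilon>0$ such that $T+\varphi$ is topologically conjugate to $T$ whenever $\varphi\in C_b(X)$ is a Lipschitz map with $\|\varphi\|_\infty\le\varepsilon$ and $\operatorname{Lip}(\varphi)\le\varepsilon$. $T$ is structurally stable relative to $GL(X)$ if there exists $\varepsilon>0$ such that $S$ is topologically conjugate to $T$ whenever $S\in GL(X)$ and $\|S-T\|\le\varepsilon$ (operator norm). $T$ is expansive if there is $c>1$ such that for each $x\in S_X$ there exists $n\in\mathbb{Z}$ with $\|T^nx\|\ge c$. $T$ is positively expansive if there is $c>1$ such that for each $x\in S_X$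 there exists $n\in\mathbb{N}$ with $\|T^nx\|\ge c$. $T$ is uniformly expansive if there exist $c>1$ and $m\in\mathbb{N}$ such that for every $x\in S_X$, $\|T^mx\|\ge c$ or $\|T^{-m}x\|\ge c$. $T$ is hyperbolic if its spectrum does not intersect the unit circle of $\mathbb{C}$. *)

theory Defs
  imports "HOL-Analysis.Analysis"
begin

class scaleC = scaleR +
  fixes scaleC :: "complex \<Rightarrow> 'a \<Rightarrow> 'a"  (infixr "*\<^sub>C" 75)
  assumes scaleR_scaleC: "scaleR r x = scaleC (complex_of_real r) x"

class complex_normed_vector = real_normed_vector + scaleC +
  assumes scaleC_add_right: "scaleC a (x + y) = scaleC a x + scaleC a y"
    and scaleC_add_left: "scaleC (a + b) x = scaleC a x + scaleC b x"
    and scaleC_scaleC: "scaleC a (scaleC b x) = scaleC (a * b) x"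
    and scaleC_one: "scaleC 1 x = x"
    and norm_scaleC: "norm (scaleC a x) = cmod a * norm x"

class cbanach = complex_normed_vector + banach

instantiation complex :: cbanach
begin

definition scaleC_complex :: "complex \<Rightarrow> complex \<Rightarrow> complex"
  where "scaleC_complex a x = a * x"

instance
  by standard
    (simp_all add: scaleC_complex_def scaleR_conv_of_real norm_mult algebra_simps)

end

definition bounded_clinear :: "('a::complex_normed_vector \<Rightarrow> 'b::complex_normed_vector) \<Rightarrow> bool"
  where "bounded_clinear T \<longleftrightarrow> bounded_linear T \<and> (\<forall>a x. T (a *\<^sub>C x) = a *\<^sub>C T x)"

definition GL :: "('a::complex_normed_vector \<Rightarrow> 'a) set"
  where "GL = {T. bounded_clinear T \<and> bij T \<and> bounded_clinear (inv T)}"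

definition spectrum :: "('a::complex_normed_vector \<Rightarrow> 'a) \<Rightarrow> complex set"
  where "spectrum T = {z. (\<lambda>x. T x - z *\<^sub>C x) \<notin> GL}"

definition topologically_conjugate ::
    "('a::topological_space \<Rightarrow> 'a) \<Rightarrow> ('a \<Rightarrow> 'a) \<Rightarrow> bool"
  where "topologically_conjugate \<phi> \<psi> \<longleftrightarrow>
    (\<exists>h g. homeomorphism UNIV UNIV h g \<and> h \<circ> \<phi> = \<psi> \<circ> h)"

text \<open>The supremum is taken in \<^typ>\<open>ennreal\<close>: it is infinite precisely for the
  non-Lipschitz maps, and it is \<open>0\<close> on the zero space, where the index set is empty.\<close>

definition Lip :: "('a::real_normed_vector \<Rightarrow> 'a) \<Rightarrow> ennreal"
  where "Lip \<phi> =
    (SUP (x, y) \<in> {(x, y). x \<noteq> y}. ennreal (norm (\<phi> x - \<phi> y) / norm (x - y)))"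

lemma Lip_le_iff_lipschitz_on:
  assumes "0 \<le> L"
  shows "Lip \<phi> \<le> ennreal L \<longleftrightarrow> L-lipschitz_on UNIV \<phi>"
proof -
  have *: "norm (\<phi> x - \<phi> y) / norm (x - y) \<le> L \<longleftrightarrow> dist (\<phi> x) (\<phi> y) \<le> L * dist x y"
    if "x \<noteq> y" for x y
    using that by (simp add: dist_norm divide_le_eq)
  show ?thesis
    using assms * unfolding Lip_def lipschitz_on_def
    by (auto simp: SUP_le_iff) (metis dist_self mult_zero_right order_refl)
qed

definition structurally_stable :: "('a::complex_normed_vector \<Rightarrow> 'a) \<Rightarrow> bool"
  where "structurally_stable T \<longleftrightarrow>
    (\<exists>\<epsilon>>0. \<forall>\<phi> :: 'a \<Rightarrow>\<^sub>C 'a. norm \<phi> \<le> \<epsilon> \<longrightarrow> Lip (apply_bcontfun \<phi>) \<le> ennreal \<epsilon> \<longrightarrow>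
      topologically_conjugate (\<lambda>x. T x + apply_bcontfun \<phi> x) T)"

definition structurally_stable_rel_GL :: "('a::complex_normed_vector \<Rightarrow> 'a) \<Rightarrow> bool"
  where "structurally_stable_rel_GL T \<longleftrightarrow>
    (\<exists>\<epsilon>>0. \<forall>S\<in>GL. onorm (\<lambda>x. S x - T x) \<le> \<epsilon> \<longrightarrow> topologically_conjugate S T)"

definition int_iterate :: "('a \<Rightarrow> 'a) \<Rightarrow> int \<Rightarrow> 'a \<Rightarrow> 'a"
  where "int_iterate T n = (if 0 \<le> n then T ^^ nat n else inv T ^^ nat (- n))"

definition expansive :: "('a::real_normed_vector \<Rightarrow> 'a) \<Rightarrow> bool"
  where "expansive T \<longleftrightarrow>
    (\<exists>c>1. \<forall>x\<in>sphere 0 1. \<exists>n. norm (int_iterate T n x) \<ge> c)"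

definition positively_expansive :: "('a::real_normed_vector \<Rightarrow> 'a) \<Rightarrow> bool"
  where "positively_expansive T \<longleftrightarrow>
    (\<exists>c>1. \<forall>x\<in>sphere 0 1. \<exists>n\<ge>1. norm ((T ^^ n) x) \<ge> c)"

definition uniformly_expansive :: "('a::real_normed_vector \<Rightarrow> 'a) \<Rightarrow> bool"
  where "uniformly_expansive T \<longleftrightarrow>
    (\<exists>c>1. \<exists>m\<ge>1. \<forall>x\<in>sphere 0 1.
      norm (int_iterate T (int m) x) \<ge> c \<or> norm (int_iterate T (- int m) x) \<ge> c)"

definition hyperbolic :: "('a::complex_normed_vector \<Rightarrow> 'a) \<Rightarrow> bool"
  where "hyperbolic T \<longleftrightarrow> spectrum T \<inter> sphere 0 1 = {}"

end

theory Submission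
  imports Defs
begin

text \<open>Suppose \<open>\<parallel>T x - \<lambda> x\<parallel>\<close> is tiny for a unit vector \<open>x\<close> and \<open>\<bar>\<lambda>\<bar> \<le> 1\<close>. A small rank-one
  perturbation \<open>S = T + f(\<cdot>) (\<lambda> x - T x)\<close>, with \<open>f\<close> a Hahn--Banach functional norming \<open>x\<close>, has
  \<open>S x = \<lambda> x\<close>; truncating \<open>f\<close> to the unit disc makes the perturbation bounded and Lipschitz
  without changing it on the disc spanned by \<open>x\<close>. That disc is compact and \<open>S\<close>-invariant, so a
  conjugacy from \<open>S\<close> to \<open>T\<close>, although it need not preserve boundedness in general, sends it to a
  bounded \<open>T\<close>-invariant set. This contradicts expansiveness if \<open>\<bar>\<lambda>\<bar> = 1\<close>, and positive
  expansiveness for every \<open>\<bar>\<lambda>\<bar> \<le> 1\<close>.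

  Hence \<open>T - \<lambda>\<close> is bounded below, uniformly in \<open>\<lambda>\<close> on the circle or on the disc. On the circle,
  an averaging argument over roots of unity gives uniform expansiveness. On the disc,
  surjectivity of \<open>T - \<lambda>\<close> propagates from \<open>\<lambda> = 0\<close> to the boundary, so \<open>T\<close> is hyperbolic.\<close>

subsection \<open>Norming functionals on complex normed spaces\<close>

lemma scaleC_zero_right [simp]: "a *\<^sub>C (0::'a::complex_normed_vector) = 0"
  using norm_scaleC[of a 0] by simp

lemma scaleC_zero_left [simp]: "0 *\<^sub>C (x::'a::complex_normed_vector) = 0"
  using norm_scaleC[of 0 x] by simp

lemma scaleC_minus_right: "a *\<^sub>C (- x) = - (a *\<^sub>C (x::'a::complex_normed_vector))"
  using scaleC_add_right[of a x "- x"] by (simp add: eq_neg_iff_add_eq_0 add.commute)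

lemma scaleC_diff_right: "a *\<^sub>C (x - y) = a *\<^sub>C x - a *\<^sub>C (y::'a::complex_normed_vector)"
  using scaleC_add_right[of a x "- y"] by (simp add: scaleC_minus_right)

lemma scaleC_minus_left: "(- a) *\<^sub>C x = - (a *\<^sub>C (x::'a::complex_normed_vector))"
  using scaleC_add_left[of a "- a" x] by (simp add: eq_neg_iff_add_eq_0 add.commute)

lemma scaleC_diff_left: "(a - b) *\<^sub>C x = a *\<^sub>C x - b *\<^sub>C (x::'a::complex_normed_vector)"
  using scaleC_add_left[of a "- b" x] by (simp add: scaleC_minus_left)

lemma scaleC_scaleR_commute: "a *\<^sub>C (r *\<^sub>R x) = r *\<^sub>R (a *\<^sub>C (x::'a::complex_normed_vector))"
  by (simp add: scaleR_scaleC scaleC_scaleC mult.commute)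

lemma scaleR_scaleC_left: "(r *\<^sub>R a) *\<^sub>C x = r *\<^sub>R (a *\<^sub>C (x::'a::complex_normed_vector))"
  by (simp add: scaleR_scaleC scaleC_scaleC scaleR_conv_of_real scaleC_complex_def)

lemma bounded_linear_scaleC_right: "bounded_linear (\<lambda>x::'a::complex_normed_vector. a *\<^sub>C x)"
  by (rule bounded_linear_intro[where K = "cmod a"])
     (simp_all add: scaleC_add_right scaleC_scaleR_commute norm_scaleC mult.commute)

lemma bounded_linear_scaleC_left: "bounded_linear (\<lambda>a. a *\<^sub>C (x::'a::complex_normed_vector))"
  by (rule bounded_linear_intro[where K = "norm x"])
     (simp_all add: scaleC_add_left scaleR_scaleC_left norm_scaleC)

section \<open>Sublinear functionals and the Hahn-Banach argument\<close>

definition sublinear :: "('a::real_vector \<Rightarrow> real) \<Rightarrow> bool"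
  where "sublinear p \<longleftrightarrow>
    (\<forall>x y. p (x + y) \<le> p x + p y) \<and> (\<forall>r x. 0 \<le> r \<longrightarrow> p (r *\<^sub>R x) = r * p x)"

lemma sublinear_zero: "sublinear p \<Longrightarrow> p 0 = 0"
  unfolding sublinear_def by (metis mult_zero_left order_refl scaleR_zero_left)

lemma sublinear_ge_neg:
  assumes "sublinear p"
  shows "- p (- x) \<le> p x"
proof -
  have "p (x + - x) \<le> p x + p (- x)"
    using assms unfolding sublinear_def by blast
  then show ?thesis
    using sublinear_zero[OF assms] by simp
qed

text \<open>Pushing \<open>p\<close> down along \<open>y\<close> forces every linear functional
  below \<open>q\<close> to take the value \<open>p y\<close> at \<open>y\<close>: the second claim
  bounds it above, the third below. The infimum is finite since \<open>- p (- u)\<close> is a lower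
  bound. Subadditivity combines parameters \<open>s\<close> and \<open>t\<close> into
  \<open>s + t\<close>; homogeneity replaces \<open>t\<close> by \<open>r * t\<close>.\<close>

lemma sublinear_shift_Inf:
  fixes p :: "'a::real_vector \<Rightarrow> real" and y :: 'a
  assumes p: "sublinear p"
  defines "q \<equiv> \<lambda>x. INF t\<in>{0..}. p (x + t *\<^sub>R y) - t * p y"
  shows "sublinear q" and "q x \<le> p x" and "q (- y) \<le> - p y"
proof -
  have add: "p (u + v) \<le> p u + p v" and scale: "0 \<le> r \<Longrightarrow> p (r *\<^sub>R u) = r * p u" for u v r
    using p unfolding sublinear_def by auto
  have lower: "- p (- u) \<le> p (u + t *\<^sub>R y) - t * p y" if "0 \<le> t" for u t
    using add[of "u + t *\<^sub>R y" "- u"] scale[OF that, of y] by simp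
  have bdd: "bdd_below ((\<lambda>t. p (u + t *\<^sub>R y) - t * p y) ` {0..})" for u
    using lower by (auto intro!: bdd_belowI2)
  have upper: "q u \<le> p (u + t *\<^sub>R y) - t * p y" if "0 \<le> t" for u t
    unfolding q_def using bdd that by (intro cINF_lower) auto
  have greatest: "l \<le> q u" if "\<And>t. 0 \<le> t \<Longrightarrow> l \<le> p (u + t *\<^sub>R y) - t * p y" for l u
    unfolding q_def using that by (intro cINF_greatest) auto
  show "q x \<le> p x"
    using upper[of 0 x] by simp
  show "q (- y) \<le> - p y"
    using upper[of 1 "- y"] sublinear_zero[OF p] by simp
  have q_add: "q (u + v) \<le> q u + q v" for u v
  proof -
    have key: "q (u + v) \<le> p (u + s *\<^sub>R y) - s * p y + (p (v + t *\<^sub>R y) - t * p y)"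
      if "0 \<le> s" "0 \<le> t" for s t
      using upper[of "s + t" "u + v"] add[of "u + s *\<^sub>R y" "v + t *\<^sub>R y"] that
      by (simp add: algebra_simps)
    have le_v: "q (u + v) - (p (u + s *\<^sub>R y) - s * p y) \<le> q v" if "0 \<le> s" for s
    proof (rule greatest)
      fix t :: real assume "0 \<le> t"
      then show "q (u + v) - (p (u + s *\<^sub>R y) - s * p y) \<le> p (v + t *\<^sub>R y) - t * p y"
        using key[OF that, of t] by linarith
    qed
    have "q (u + v) - q v \<le> p (u + s *\<^sub>R y) - s * p y" if "0 \<le> s" for s
      using le_v[OF that] by linarith
    then have "q (u + v) - q v \<le> q u"
      by (rule greatest)
    then show ?thesis by simp
  qed
  have q_scale_le: "q (r *\<^sub>R u) \<le> r * q u" if "0 < r" for r u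
  proof -
    have "q (r *\<^sub>R u) / r \<le> p (u + t *\<^sub>R y) - t * p y" if "0 \<le> t" for t
    proof -
      have "p (r *\<^sub>R u + (r * t) *\<^sub>R y) = r * p (u + t *\<^sub>R y)"
        using scale[of r "u + t *\<^sub>R y"] \<open>0 < r\<close> by (simp add: scaleR_add_right)
      then have "q (r *\<^sub>R u) \<le> r * p (u + t *\<^sub>R y) - (r * t) * p y"
        using upper[of "r * t" "r *\<^sub>R u"] \<open>0 < r\<close> that by simp
      also have "\<dots> = r * (p (u + t *\<^sub>R y) - t * p y)"
        by (simp add: right_diff_distrib)
      finally show ?thesis
        using \<open>0 < r\<close> by (simp only: pos_divide_le_eq mult.commute)
    qed
    then have "q (r *\<^sub>R u) / r \<le> q u"
      by (rule greatest)
    then show ?thesis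
      using that by (simp add: pos_divide_le_eq mult.commute)
  qed
  have "q 0 = 0"
  proof (rule order_antisym)
    show "q 0 \<le> 0"
      using upper[of 0 0] sublinear_zero[OF p] by simp
    show "0 \<le> q 0"
      by (rule greatest) (simp add: scale)
  qed
  have q_scale: "q (r *\<^sub>R u) = r * q u" if "0 \<le> r" for r u
  proof (cases "r = 0")
    case True
    then show ?thesis using \<open>q 0 = 0\<close> by simp
  next
    case False
    then have "0 < r" using that by simp
    \<comment> \<open>The one-sided estimate for the factor \<open>inverse r\<close> at the point
      \<open>r *\<^sub>R u\<close> is the reverse inequality.\<close>
    moreover have "r * q u \<le> q (r *\<^sub>R u)"
      using q_scale_le[of "inverse r" "r *\<^sub>R u"] \<open>0 < r\<close> by (simp add: divide_simps mult.commute)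
    ultimately show ?thesis
      using q_scale_le[of r u] by simp
  qed
  show "sublinear q"
    unfolding sublinear_def using q_add q_scale by blast
qed

text \<open>This supplies the bounds for chains in Zorn's lemma. The common bound \<open>b\<close>
  gives the lower bound \<open>- b (- x)\<close>, so the pointwise infimum is finite. Comparability
  enters in subadditivity: two members \<open>p\<close> and \<open>p'\<close> are replaced by the
  smaller one, whose own subadditivity applies.\<close>

lemma sublinear_Inf_chain:
  fixes C :: "('a::real_vector \<Rightarrow> real) set"
  assumes "C \<noteq> {}" and sub: "\<And>p. p \<in> C \<Longrightarrow> sublinear p"
    and bound: "\<And>p x. p \<in> C \<Longrightarrow> p x \<le> b x"
    and chain: "\<And>p p'. p \<in> C \<Longrightarrow> p' \<in> C \<Longrightarrow> p \<le> p' \<or> p' \<le> p"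
  defines "q \<equiv> \<lambda>x. INF p\<in>C. p x"
  shows "sublinear q" and "p \<in> C \<Longrightarrow> q \<le> p"
proof -
  have "- b (- x) \<le> p x" if "p \<in> C" for p x
    using sublinear_ge_neg[OF sub[OF that], of x] bound[OF that, of "- x"] by simp
  then have bdd: "bdd_below ((\<lambda>p. p x) ` C)" for x
    by (auto intro!: bdd_belowI2)
  have lower: "q x \<le> p x" if "p \<in> C" for p x
    unfolding q_def using bdd that by (intro cINF_lower) auto
  have greatest: "l \<le> q x" if "\<And>p. p \<in> C \<Longrightarrow> l \<le> p x" for l x
    unfolding q_def using that \<open>C \<noteq> {}\<close> by (intro cINF_greatest) auto
  show "p \<in> C \<Longrightarrow> q \<le> p"
    using lower by (simp add: le_fun_def)
  have "q (x + y) \<le> q x + q y" for x y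
  proof -
    have key: "q (x + y) \<le> p x + p' y" if pp': "p \<in> C" "p' \<in> C" for p p'
    proof -
      obtain r where r: "r \<in> C" "r \<le> p" "r \<le> p'"
        using chain[OF pp'] pp' by auto
      have "q (x + y) \<le> r (x + y)"
        using lower r by blast
      also have "\<dots> \<le> r x + r y"
        using sub[OF r(1)] unfolding sublinear_def by blast
      also have "\<dots> \<le> p x + p' y"
        using r by (intro add_mono) (auto simp: le_fun_def)
      finally show ?thesis .
    qed
    have le_y: "q (x + y) - p x \<le> q y" if "p \<in> C" for p
    proof (rule greatest)
      fix p' assume "p' \<in> C"
      then show "q (x + y) - p x \<le> p' y"
        using key[OF that, of p'] by linarith
    qed
    have "q (x + y) - q y \<le> p x" if "p \<in> C" for p
      using le_y[OF that] by linarith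
    then have "q (x + y) - q y \<le> q x"
      by (rule greatest)
    then show ?thesis by simp
  qed
  moreover have "q (r *\<^sub>R x) = r * q x" if "0 \<le> r" for r x
  proof (cases "r = 0")
    case True
    have "q 0 = (INF p\<in>C. 0)"
      unfolding q_def using sub sublinear_zero by (intro INF_cong) auto
    then show ?thesis
      using True \<open>C \<noteq> {}\<close> by simp
  next
    case False
    then have "0 < r" using that by simp
    have scale: "p (r *\<^sub>R x) = r * p x" if "p \<in> C" for p
      using sub[OF that] \<open>0 \<le> r\<close> unfolding sublinear_def by blast
    have "q (r *\<^sub>R x) / r \<le> q x"
    proof (rule greatest)
      fix p assume "p \<in> C"
      then show "q (r *\<^sub>R x) / r \<le> p x"
        using lower[of p "r *\<^sub>R x"] scale[of p] \<open>0 < r\<close> by (simp add: pos_divide_le_eq mult.commute)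
    qed
    moreover have "r * q x \<le> q (r *\<^sub>R x)"
      by (rule greatest) (simp only: scale, intro mult_left_mono lower that)
    ultimately show ?thesis
      using \<open>0 < r\<close> by (simp add: pos_divide_le_eq mult.commute)
  qed
  ultimately show "sublinear q"
    unfolding sublinear_def by blast
qed

text \<open>A minimal sublinear functional below \<open>p\<close> is linear: \<open>sublinear_shift_Inf\<close> would
  otherwise produce a strictly smaller one.\<close>

lemma linear_below_sublinear:
  fixes p :: "'a::real_vector \<Rightarrow> real"
  assumes p: "sublinear p"
  obtains g where "linear g" and "\<And>x. g x \<le> p x"
proof -
  define A where "A = {q. sublinear q \<and> q \<le> p}"
  \<comment> \<open>Zorn's lemma for the reversed order: its maximal elements are the minimal
    sublinear functionals.\<close>
  have "\<exists>m\<in>A. \<forall>q\<in>A. m \<ge> q \<longrightarrow> q = m"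
  proof (rule predicate_Zorn)
    show "partial_order_on A (relation_of (\<lambda>a b. b \<le> a) A)"
      by (rule partial_order_on_relation_ofI) auto
  next
    fix C assume C: "C \<in> Chains (relation_of (\<lambda>a b. b \<le> a) A)"
    show "\<exists>u\<in>A. \<forall>a\<in>C. u \<le> a"
    proof (cases "C = {}")
      case True
      then show ?thesis using p A_def by auto
    next
      case False
      have CA: "q \<in> C \<Longrightarrow> q \<in> A" and chain: "q \<in> C \<Longrightarrow> q' \<in> C \<Longrightarrow> q \<le> q' \<or> q' \<le> q" for q q'
        using C unfolding Chains_def relation_of_def by auto
      have sub: "\<And>q. q \<in> C \<Longrightarrow> sublinear q" and le: "\<And>q x. q \<in> C \<Longrightarrow> q x \<le> p x"
        using CA by (auto simp: A_def le_fun_def)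
      have inf: "sublinear (\<lambda>x. INF q\<in>C. q x)"
        by (rule sublinear_Inf_chain(1)[where b = p]) (fact False sub le chain)+
      have inf_le: "(\<lambda>x. INF q\<in>C. q x) \<le> q'" if "q' \<in> C" for q'
        by (rule sublinear_Inf_chain(2)[where b = p]) (fact False sub le chain that)+
      obtain q' where "q' \<in> C"
        using False by blast
      then have "(\<lambda>x. INF q\<in>C. q x) \<le> p"
        using order_trans[OF inf_le] CA A_def by blast
      with inf show ?thesis
        unfolding A_def by (intro bexI[where x = "\<lambda>x. INF q\<in>C. q x"] ballI inf_le) simp_all
    qed
  qed
  then obtain m where m: "sublinear m" "m \<le> p" and min: "\<And>q. sublinear q \<Longrightarrow> q \<le> m \<Longrightarrow> q = m"
    unfolding A_def by (metis (no_types, lifting) mem_Collect_eq order.trans)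
  have neg: "m (- y) = - m y" for y
  proof -
    define q where "q x = (INF t\<in>{0..}. m (x + t *\<^sub>R y) - t * m y)" for x
    note q = sublinear_shift_Inf[where y = y, OF m(1), folded q_def]
    have "q = m"
      by (rule min[OF q(1)]) (simp add: le_fun_def q(2))
    then have "m (- y) \<le> - m y"
      using q(3) by simp
    then show ?thesis
      using sublinear_ge_neg[OF m(1), of y] by linarith
  qed
  have sub: "m (x + y) \<le> m x + m y" and scale: "0 \<le> r \<Longrightarrow> m (r *\<^sub>R x) = r * m x" for x y r
    using m(1) unfolding sublinear_def by auto
  \<comment> \<open>Since \<open>m\<close> is odd, subadditivity for \<open>x + y\<close> and
    \<open>- y\<close> gives the missing inequality.\<close>
  have add: "m (x + y) = m x + m y" for x y
    using sub[of x y] sub[of "x + y" "- y"] neg[of y] by simp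
  have "m (r *\<^sub>R x) = r * m x" for r x
    using scale[of r x] scale[of "- r" x] neg[of "r *\<^sub>R x"] by (cases "0 \<le> r") auto
  then have "linear m"
    using add by (intro linearI) auto
  then show thesis
    using that m(2) by (auto simp: le_fun_def)
qed

text \<open>Shifting the norm along \<open>x0\<close> before taking a linear minorant pins the value
  at \<open>x0\<close>: \<open>- g x0 = g (- x0) \<le> q (- x0) \<le> - norm x0\<close>.\<close>

lemma real_norming_functional:
  fixes x0 :: "'a::real_normed_vector"
  obtains g where "linear g" and "\<And>x. g x \<le> norm x" and "g x0 = norm x0"
proof -
  define q where "q x = (INF t\<in>{0..}. norm (x + t *\<^sub>R x0) - t * norm x0)" for x
  have "sublinear (norm :: 'a \<Rightarrow> real)"
    unfolding sublinear_def by (auto intro: norm_triangle_ineq)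
  note q = sublinear_shift_Inf[where y = x0, OF this, folded q_def]
  obtain g where g: "linear g" "\<And>x. g x \<le> q x"
    using linear_below_sublinear[OF q(1)] by blast
  have "g x0 = norm x0"
    using g(2)[of "- x0"] q(3) g(2)[of x0] q(2)[of x0] linear_neg[OF g(1), of x0] by linarith
  then show thesis
    using that[of g] g order_trans[OF g(2) q(2)] by simp
qed

text \<open>A real functional \<open>g\<close> is the real part of the complex-linear functional
  \<open>g x - \<i> * g (\<i> *\<^sub>C x)\<close>, and the norm bound survives
  complexification.\<close>

lemma norming_functional:
  fixes x0 :: "'a::complex_normed_vector"
  obtains f where "bounded_clinear (f :: 'a \<Rightarrow> complex)" and "\<And>x. cmod (f x) \<le> norm x"
    and "f x0 = norm x0"
proof -
  obtain g where g: "linear g" "\<And>x. g x \<le> norm x" "g x0 = norm x0"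
    using real_norming_functional by blast
  define f where "f x = Complex (g x) (- g (\<i> *\<^sub>C x))" for x
  have f_add: "f (x + y) = f x + f y" for x y
    by (simp add: f_def complex_eq_iff linear_add[OF g(1)] scaleC_add_right)
  have f_scaleR: "f (r *\<^sub>R x) = r *\<^sub>R f x" for r x
    by (simp add: f_def complex_eq_iff linear_scale[OF g(1)] scaleC_scaleR_commute)
  have f_i: "f (\<i> *\<^sub>C x) = \<i> * f x" for x
    by (simp add: f_def complex_eq_iff scaleC_scaleC scaleC_minus_left scaleC_one
        linear_neg[OF g(1)])
  have f_scaleC: "f (a *\<^sub>C x) = a * f x" for a x
  proof -
    have "a *\<^sub>C x = Re a *\<^sub>R x + Im a *\<^sub>R (\<i> *\<^sub>C x)"
      using complex_eq[of a] by (metis scaleC_add_left scaleC_scaleC mult.commute scaleR_scaleC)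
    then have "f (a *\<^sub>C x) = (of_real (Re a) + \<i> * of_real (Im a)) * f x"
      by (simp add: f_add f_scaleR f_i scaleR_conv_of_real algebra_simps)
    then show ?thesis
      using complex_eq[of a] by simp
  qed
  have f_le: "cmod (f x) \<le> norm x" for x
  proof -
    \<comment> \<open>The unimodular factor (zero if \<open>f x = 0\<close>) rotates
      \<open>f x\<close> onto the nonnegative reals, where \<open>f\<close> agrees with its real
      part \<open>g\<close>.\<close>
    define u where "u = cnj (sgn (f x))"
    have "u * f x = of_real (cmod (f x))"
      using complex_norm_square[of "f x"]
      by (cases "f x = 0") (simp_all add: u_def sgn_eq field_simps power2_eq_square)
    then have "of_real (cmod (f x)) = f (u *\<^sub>C x)"
      by (simp add: f_scaleC)
    then have "cmod (f x) = g (u *\<^sub>C x)"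
      by (metis Re_complex_of_real complex.sel(1) f_def)
    also have "\<dots> \<le> cmod u * norm x"
      using g(2)[of "u *\<^sub>C x"] by (simp add: norm_scaleC)
    also have "\<dots> \<le> norm x"
      by (simp add: u_def norm_sgn)
    finally show ?thesis .
  qed
  \<comment> \<open>The real part already exhausts the bound on the modulus, so the imaginary part
    must vanish.\<close>
  have "(Re (f x0))\<^sup>2 + (Im (f x0))\<^sup>2 \<le> (norm x0)\<^sup>2"
    using power_mono[OF f_le[of x0], of 2] by (simp add: cmod_power2)
  moreover have "Re (f x0) = norm x0"
    by (simp add: f_def g(3))
  ultimately have "f x0 = norm x0"
    by (simp add: complex_eq_iff)
  moreover have "bounded_linear f"
    using f_le by (intro bounded_linear_intro[where K = 1]) (auto simp: f_add f_scaleR)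
  ultimately show thesis
    using that[of f] f_le by (auto simp: bounded_clinear_def f_scaleC scaleC_complex_def)
qed

subsection \<open>Invertible operators and rank-one perturbations\<close>

lemma bounded_clinearD:
  assumes "bounded_clinear T"
  shows "bounded_linear T" and "linear T" and "T (a *\<^sub>C x) = a *\<^sub>C T x"
  using assms by (auto simp: bounded_clinear_def bounded_linear.linear)

lemma GL_I:
  assumes "bounded_clinear S" "bounded_clinear R" "\<And>x. S (R x) = x" "\<And>x. R (S x) = x"
  shows "S \<in> GL"
proof -
  have "bij S"
    using assms by (intro o_bij[of R]) (auto simp: fun_eq_iff)
  moreover have "inv S = R"
    using assms by (intro inv_equality)
  ultimately show ?thesis
    using assms by (simp add: GL_def)
qed

lemma GL_D:
  assumes "T \<in> GL"
  shows "bounded_clinear T" and "bounded_clinear (inv T)" and "bij T"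
    and "T (inv T x) = x" and "inv T (T x) = x"
  using assms by (auto simp: GL_def bij_is_surj surj_f_inv_f bij_is_inj)

text \<open>The lower bound gives injectivity and the bound \<open>inverse \<epsilon>\<close> for
  the inverse, so only surjectivity remains to be checked for such operators.\<close>

lemma bounded_below_surj_in_GL:
  assumes S: "bounded_clinear S" and "surj S" and "0 < \<epsilon>"
    and below: "\<And>x. \<epsilon> * norm x \<le> norm (S x)"
  shows "S \<in> GL"
proof -
  note S_lin = bounded_clinearD(2)[OF S]
  have "inj S"
    using below \<open>0 < \<epsilon>\<close>
    by (intro linear_injective_0[OF S_lin, THEN iffD2]) (metis mult_le_0_iff norm_le_zero_iff norm_zero not_le)
  then have S_inv: "S (inv S x) = x" "inv S (S x) = x" for x
    using \<open>surj S\<close> by (auto simp: surj_f_inv_f)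
  have "bounded_linear (inv S)"
  proof (rule bounded_linear_intro)
    show "inv S (x + y) = inv S x + inv S y" for x y
      by (rule injD[OF \<open>inj S\<close>]) (simp add: linear_add[OF S_lin] S_inv)
    show "inv S (r *\<^sub>R x) = r *\<^sub>R inv S x" for r x
      by (rule injD[OF \<open>inj S\<close>]) (simp add: linear_scale[OF S_lin] S_inv)
    show "norm (inv S x) \<le> norm x * inverse \<epsilon>" for x
      using below[of "inv S x"] \<open>0 < \<epsilon>\<close> by (simp add: S_inv field_simps)
  qed
  moreover have "inv S (a *\<^sub>C x) = a *\<^sub>C inv S x" for a x
    by (rule injD[OF \<open>inj S\<close>]) (simp add: bounded_clinearD(3)[OF S] S_inv)
  ultimately have "bounded_clinear (inv S)"
    by (simp add: bounded_clinear_def)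
  then show ?thesis
    using GL_I[OF S] S_inv by blast
qed

lemma bounded_clinear_rank_one:
  assumes "bounded_clinear (f :: 'a::complex_normed_vector \<Rightarrow> complex)"
  shows "bounded_clinear (\<lambda>x. f x *\<^sub>C v)"
  using bounded_linear_compose[OF bounded_linear_scaleC_left bounded_clinearD(1)[OF assms]]
  by (auto simp: bounded_clinear_def bounded_clinearD(3)[OF assms] scaleC_complex_def scaleC_scaleC)

lemma bounded_clinear_add:
  "bounded_clinear S \<Longrightarrow> bounded_clinear R \<Longrightarrow> bounded_clinear (\<lambda>x. S x + R x)"
  by (simp add: bounded_clinear_def bounded_linear_add scaleC_add_right)

lemma bounded_clinear_compose:
  "bounded_clinear S \<Longrightarrow> bounded_clinear R \<Longrightarrow> bounded_clinear (\<lambda>x. S (R x))"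
  by (simp add: bounded_clinear_def bounded_linear_compose)

text \<open>The inverse is given by the Sherman-Morrison formula, with \<open>w = inv T v\<close>
  and denominator \<open>c = 1 + f w\<close>.\<close>

lemma GL_add_rank_one:
  fixes T :: "'a::complex_normed_vector \<Rightarrow> 'a"
  assumes T: "T \<in> GL" and f: "bounded_clinear (f :: 'a \<Rightarrow> complex)"
    and nz: "1 + f (inv T v) \<noteq> 0"
  shows "(\<lambda>x. T x + f x *\<^sub>C v) \<in> GL"
proof -
  define w where "w = inv T v"
  define c where "c = 1 + f w"
  have "c \<noteq> 0"
    using nz by (simp add: c_def w_def)
  have fw: "f w = c - 1"
    by (simp add: c_def)
  note Ti = GL_D[OF T]
  note lin = bounded_clinearD(2)[OF Ti(1)] bounded_clinearD(2)[OF Ti(2)] bounded_clinearD(2)[OF f]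
  note add = lin[THEN linear_add] and cscale = bounded_clinearD(3)[OF Ti(1)]
    bounded_clinearD(3)[OF Ti(2)] bounded_clinearD(3)[OF f]
  have Tw: "T w = v"
    by (simp add: w_def Ti)
  show ?thesis
  proof (rule GL_I)
    show "bounded_clinear (\<lambda>x. T x + f x *\<^sub>C v)"
      by (intro bounded_clinear_add bounded_clinear_rank_one Ti f)
    show "bounded_clinear (\<lambda>y. inv T y + f (inv T y) *\<^sub>C ((- 1 / c) *\<^sub>C w))"
      by (intro bounded_clinear_add bounded_clinear_compose[OF bounded_clinear_rank_one[OF f]] Ti)
  next
    fix y
    \<comment> \<open>This is the total coefficient of \<open>v\<close> after applying the perturbed
      operator to the candidate inverse.\<close>
    have "f (inv T y) + f (inv T y) * (- 1 / c) * (c - 1) + f (inv T y) * (- 1 / c) = 0"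
      using \<open>c \<noteq> 0\<close> by (simp add: field_simps)
    then show "T (inv T y + f (inv T y) *\<^sub>C ((- 1 / c) *\<^sub>C w))
        + f (inv T y + f (inv T y) *\<^sub>C ((- 1 / c) *\<^sub>C w)) *\<^sub>C v = y"
      unfolding scaleC_scaleC
      by (simp add: add cscale Ti Tw fw scaleC_complex_def flip: scaleC_add_left)
  next
    fix x
    have *: "inv T (T x + f x *\<^sub>C v) = x + f x *\<^sub>C w"
      by (simp add: add cscale Ti w_def)
    have "f (x + f x *\<^sub>C w) = f x * c"
      by (simp add: add cscale fw scaleC_complex_def algebra_simps)
    then have "f (x + f x *\<^sub>C w) * (- 1 / c) = - f x"
      using \<open>c \<noteq> 0\<close> by simp
    then show "inv T (T x + f x *\<^sub>C v) + f (inv T (T x + f x *\<^sub>C v)) *\<^sub>C ((- 1 / c) *\<^sub>C w) = x"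
      unfolding * scaleC_scaleC by (simp only: scaleC_minus_left) simp
  qed
qed

section \<open>Conjugacies along an approximate eigenvector\<close>

lemma stable_imp_conjugate_eigenline:
  fixes T :: "'a::complex_normed_vector \<Rightarrow> 'a"
  assumes T: "T \<in> GL" and stable: "structurally_stable T \<or> structurally_stable_rel_GL T"
  obtains \<epsilon> where "0 < \<epsilon>"
    and "\<And>x l. norm x = 1 \<Longrightarrow> cmod l \<le> 1 \<Longrightarrow> norm (T x - l *\<^sub>C x) < \<epsilon> \<Longrightarrow>
      \<exists>h. continuous_on UNIV h \<and> inj h \<and> (\<forall>m\<in>cball 0 1. h ((l * m) *\<^sub>C x) = T (h (m *\<^sub>C x)))"
proof -
  note lin = bounded_clinearD(1)[OF GL_D(1)[OF T]]
  note cscale = bounded_clinearD(3)[OF GL_D(1)[OF T]]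
  \<comment> \<open>Both notions of stability feed into this step. The eigenvector equation is asked
    for on the unit disc only, because the truncated perturbation is linear in \<open>m\<close> only
    there.\<close>
  have conj: "\<exists>h. continuous_on UNIV h \<and> inj h \<and>
      (\<forall>m\<in>cball 0 1. h ((l * m) *\<^sub>C x) = T (h (m *\<^sub>C x)))"
    if "topologically_conjugate S T" and S: "\<And>m. m \<in> cball 0 1 \<Longrightarrow> S (m *\<^sub>C x) = (l * m) *\<^sub>C x"
    for S x l
  proof -
    obtain h g where h: "homeomorphism UNIV UNIV h g" "h \<circ> S = T \<circ> h"
      using \<open>topologically_conjugate S T\<close> unfolding topologically_conjugate_def by blast
    then have "continuous_on UNIV h" "inj h"
      by (auto simp: homeomorphism_def intro: inj_on_inverseI)
    moreover have "h ((l * m) *\<^sub>C x) = T (h (m *\<^sub>C x))" if "m \<in> cball 0 1" for m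
      using S[OF that] h(2) by (metis comp_apply)
    ultimately show ?thesis by blast
  qed
  from stable show thesis
  proof
    assume "structurally_stable T"
    then obtain \<epsilon> where "0 < \<epsilon>" and \<epsilon>: "\<And>\<phi> :: 'a \<Rightarrow>\<^sub>C 'a. norm \<phi> \<le> \<epsilon> \<Longrightarrow>
        Lip (apply_bcontfun \<phi>) \<le> ennreal \<epsilon> \<Longrightarrow>
        topologically_conjugate (\<lambda>x. T x + apply_bcontfun \<phi> x) T"
      unfolding structurally_stable_def by blast
    show thesis
    proof (rule that[OF \<open>0 < \<epsilon>\<close>])
      fix x :: 'a and l :: complex
      assume x: "norm x = 1" and l: "cmod l \<le> 1" "norm (T x - l *\<^sub>C x) < \<epsilon>"
      define v where "v = l *\<^sub>C x - T x"
      have v: "norm v \<le> \<epsilon>"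
        using l unfolding v_def by (simp add: norm_minus_commute)
      obtain f where f: "bounded_clinear (f :: 'a \<Rightarrow> complex)" "\<And>y. cmod (f y) \<le> norm y"
          "f x = norm x"
        using norming_functional by blast
      \<comment> \<open>The nearest-point retraction onto the disc is bounded by 1, 1-Lipschitz and
        fixes the disc, so the sup norm and the Lipschitz constant of \<open>\<phi>\<close> are both
        controlled by \<open>norm v\<close>.\<close>
      define \<rho> where "\<rho> = closest_point (cball (0::complex) 1)"
      define \<phi> where "\<phi> y = \<rho> (f y) *\<^sub>C v" for y
      have \<rho>_le: "cmod (\<rho> z) \<le> 1" for z
        using closest_point_in_set[of "cball (0::complex) 1" z] by (simp add: \<rho>_def)
      have \<rho>_lip: "cmod (\<rho> z - \<rho> z') \<le> cmod (z - z')" for z z'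
        using closest_point_lipschitz[of "cball (0::complex) 1" z z'] by (simp add: \<rho>_def dist_norm)
      have \<phi>_le: "norm (\<phi> y) \<le> \<epsilon>" for y
        using mult_mono[OF \<rho>_le[of "f y"] v] by (simp add: \<phi>_def norm_scaleC)
      have "norm (\<phi> y - \<phi> z) \<le> \<epsilon> * norm (y - z)" for y z
      proof -
        have "cmod (\<rho> (f y) - \<rho> (f z)) \<le> norm (y - z)"
          using \<rho>_lip[of "f y" "f z"] f(2)[of "y - z"]
          by (simp add: linear_diff[OF bounded_clinearD(2)[OF f(1)]])
        from mult_mono[OF v this] show ?thesis
          using \<open>0 < \<epsilon>\<close> by (simp add: \<phi>_def norm_scaleC mult.commute flip: scaleC_diff_left)
      qed
      then have lip: "\<epsilon>-lipschitz_on UNIV \<phi>"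
        using \<open>0 < \<epsilon>\<close> by (intro lipschitz_onI) (auto simp: dist_norm)
      then have "\<phi> \<in> bcontfun"
        using \<phi>_le unfolding bcontfun_def bounded_iff
        by (auto intro: lipschitz_on_continuous_on)
      then have apply_\<phi>: "apply_bcontfun (Bcontfun \<phi>) = \<phi>"
        by (rule Bcontfun_inverse)
      have "topologically_conjugate (\<lambda>y. T y + \<phi> y) T"
        using \<epsilon>[of "Bcontfun \<phi>"] lip \<phi>_le \<open>0 < \<epsilon>\<close>
        by (simp add: apply_\<phi> norm_bound Lip_le_iff_lipschitz_on)
      then show "\<exists>h. continuous_on UNIV h \<and> inj h \<and>
          (\<forall>m\<in>cball 0 1. h ((l * m) *\<^sub>C x) = T (h (m *\<^sub>C x)))"
      proof (rule conj)
        fix m :: complex assume m: "m \<in> cball 0 1"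
        have "f (m *\<^sub>C x) = m"
          using f(3) x by (simp add: bounded_clinearD(3)[OF f(1)] scaleC_complex_def)
        then have "\<phi> (m *\<^sub>C x) = m *\<^sub>C v"
          using closest_point_self[OF m] by (simp add: \<phi>_def \<rho>_def)
        then show "T (m *\<^sub>C x) + \<phi> (m *\<^sub>C x) = (l * m) *\<^sub>C x"
          by (simp add: cscale v_def scaleC_diff_right scaleC_scaleC mult.commute)
      qed
    qed
  next
    assume "structurally_stable_rel_GL T"
    then obtain \<epsilon> where "0 < \<epsilon>" and \<epsilon>: "\<And>S. S \<in> GL \<Longrightarrow> onorm (\<lambda>x. S x - T x) \<le> \<epsilon> \<Longrightarrow>
        topologically_conjugate S T"
      unfolding structurally_stable_rel_GL_def by blast
    obtain K where "0 < K" and K: "\<And>y. norm (inv T y) \<le> norm y * K"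
      using bounded_linear.pos_bounded[OF bounded_clinearD(1)[OF GL_D(2)[OF T]]] by blast
    \<comment> \<open>The bound \<open>1 / K\<close> keeps \<open>f (inv T v)\<close> inside the
      open unit disc, so that the rank-one perturbation is invertible.\<close>
    have "0 < min \<epsilon> (1 / K)"
      using \<open>0 < \<epsilon>\<close> \<open>0 < K\<close> by simp
    then show thesis
    proof (rule that)
      fix x :: 'a and l :: complex
      assume x: "norm x = 1" and l: "cmod l \<le> 1" "norm (T x - l *\<^sub>C x) < min \<epsilon> (1 / K)"
      define v where "v = l *\<^sub>C x - T x"
      have v: "norm v < \<epsilon>" "norm v < 1 / K"
        using l unfolding v_def by (simp_all add: norm_minus_commute)
      obtain f where f: "bounded_clinear (f :: 'a \<Rightarrow> complex)" "\<And>y. cmod (f y) \<le> norm y"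
          "f x = norm x"
        using norming_functional by blast
      have "cmod (f (inv T v)) \<le> norm v * K"
        using f(2) K order_trans by blast
      also have "\<dots> < 1"
        using v(2) \<open>0 < K\<close> by (simp add: field_simps)
      finally have "f (inv T v) \<noteq> - 1"
        by (auto simp: norm_minus_cancel)
      then have GL: "(\<lambda>y. T y + f y *\<^sub>C v) \<in> GL"
        by (intro GL_add_rank_one[OF T f(1)]) (metis add_eq_0_iff)
      have "onorm (\<lambda>y. f y *\<^sub>C v) \<le> \<epsilon>"
      proof (rule onorm_bound)
        show "norm (f y *\<^sub>C v) \<le> \<epsilon> * norm y" for y
          using mult_mono[OF f(2)[of y] less_imp_le[OF v(1)]] \<open>0 < \<epsilon>\<close>
          by (simp add: norm_scaleC mult.commute)
      qed (use \<open>0 < \<epsilon>\<close> in simp)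
      then have "topologically_conjugate (\<lambda>y. T y + f y *\<^sub>C v) T"
        by (intro \<epsilon>[OF GL]) simp
      then show "\<exists>h. continuous_on UNIV h \<and> inj h \<and>
          (\<forall>m\<in>cball 0 1. h ((l * m) *\<^sub>C x) = T (h (m *\<^sub>C x)))"
      proof (rule conj)
        fix m :: complex
        have "f (m *\<^sub>C x) = m"
          using f(3) x by (simp add: bounded_clinearD(3)[OF f(1)] scaleC_complex_def)
        then show "T (m *\<^sub>C x) + f (m *\<^sub>C x) *\<^sub>C v = (l * m) *\<^sub>C x"
          by (simp add: cscale v_def scaleC_diff_right scaleC_scaleC mult.commute)
      qed
    qed
  qed
qed

subsection \<open>Bounded invariant sets\<close>

text \<open>The supremum \<open>s\<close> of the norms satisfies \<open>s \<le> s / c\<close>, which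
  forces \<open>s \<le> 0\<close>; it need not be attained.\<close>

lemma bounded_expanding_set_trivial:
  fixes K :: "'a::real_normed_vector set"
  assumes "bounded K" and "1 < c"
    and expand: "\<And>y. y \<in> K \<Longrightarrow> y \<noteq> 0 \<Longrightarrow> \<exists>y'\<in>K. c * norm y \<le> norm y'"
  shows "K \<subseteq> {0}"
proof
  fix y assume "y \<in> K"
  define s where "s = (SUP y\<in>K. norm y)"
  have bdd: "bdd_above (norm ` K)"
    using \<open>bounded K\<close> by (auto simp: bounded_iff intro: bdd_aboveI2)
  have le_s: "norm y \<le> s" if "y \<in> K" for y
    unfolding s_def using that bdd by (intro cSUP_upper) auto
  have "0 \<le> s"
    using le_s[OF \<open>y \<in> K\<close>] norm_ge_zero[of y] by linarith
  have "norm y \<le> s / c" if "y \<in> K" for y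
  proof (cases "y = 0")
    case True
    then show ?thesis using \<open>0 \<le> s\<close> \<open>1 < c\<close> by simp
  next
    case False
    then have "c * norm y \<le> s"
      using expand[OF that] le_s by fastforce
    then show ?thesis
      using \<open>1 < c\<close> by (simp add: pos_le_divide_eq mult.commute)
  qed
  then have "s \<le> s / c"
    unfolding s_def using \<open>y \<in> K\<close> by (intro cSUP_least) auto
  then have "s * (c - 1) \<le> 0"
    using \<open>1 < c\<close> by (simp add: pos_le_divide_eq algebra_simps)
  then have "s \<le> 0"
    using \<open>1 < c\<close> by (simp add: mult_le_0_iff)
  then show "y \<in> {0}"
    using le_s[OF \<open>y \<in> K\<close>] norm_ge_zero[of y] by (metis order_trans norm_le_zero_iff singletonI)
qed

lemma linear_funpow: "linear (T :: 'a::real_vector \<Rightarrow> 'a) \<Longrightarrow> linear (T ^^ n)"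
  by (induction n) (auto simp: linear_iff)

lemma linear_int_iterate:
  assumes "T \<in> GL"
  shows "linear (int_iterate T n)"
  using GL_D[OF assms] by (simp add: int_iterate_def linear_funpow bounded_clinearD(2))

lemma linear_expand_rescale:
  assumes "linear S" and "c \<le> norm (S (x /\<^sub>R norm x))" and "x \<noteq> 0"
  shows "c * norm x \<le> norm (S x)"
proof -
  have "norm (S (x /\<^sub>R norm x)) = norm (S x) / norm x"
    by (simp add: linear_scale[OF assms(1)] divide_inverse)
  then show ?thesis
    using assms by (simp add: pos_le_divide_eq)
qed

lemma expansive_no_bounded_orbit:
  assumes T: "T \<in> GL" and "expansive T" and "bounded K" and "T ` K = K"
  shows "K \<subseteq> {0}"
proof -
  obtain c where "1 < c" and c: "\<And>x. norm x = 1 \<Longrightarrow> \<exists>n. c \<le> norm (int_iterate T n x)"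
    using \<open>expansive T\<close> unfolding expansive_def by auto
  have "inv T ` K = K"
  proof -
    have "inv T ` K = inv T ` T ` K"
      by (simp only: \<open>T ` K = K\<close>)
    then show ?thesis
      by (simp add: image_image GL_D(5)[OF T])
  qed
  then have pow: "(T ^^ k) ` K = K" "(inv T ^^ k) ` K = K" for k
    using \<open>T ` K = K\<close> by (induction k) (simp_all only: funpow.simps id_apply image_id image_comp[symmetric])
  show ?thesis
    using \<open>bounded K\<close> \<open>1 < c\<close>
  proof (rule bounded_expanding_set_trivial)
    fix y assume y: "y \<in> K" "y \<noteq> 0"
    then obtain n where "c \<le> norm (int_iterate T n (y /\<^sub>R norm y))"
      using c[of "y /\<^sub>R norm y"] by auto
    then have "c * norm y \<le> norm (int_iterate T n y)"
      using linear_expand_rescale[OF linear_int_iterate[OF T]] y by blast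
    moreover have "int_iterate T n y \<in> K"
      using imageI[OF y(1), of "T ^^ nat n"] imageI[OF y(1), of "inv T ^^ nat (- n)"]
      by (simp add: pow int_iterate_def)
    ultimately show "\<exists>y'\<in>K. c * norm y \<le> norm y'"
      by blast
  qed
qed

text \<open>Only forward iterates occur, so forward invariance suffices.\<close>

lemma positively_expansive_no_bounded_orbit:
  assumes T: "T \<in> GL" and "positively_expansive T" and "bounded K" and "T ` K \<subseteq> K"
  shows "K \<subseteq> {0}"
proof -
  obtain c where "1 < c" and c: "\<And>x. norm x = 1 \<Longrightarrow> \<exists>n. c \<le> norm ((T ^^ n) x)"
    using \<open>positively_expansive T\<close> unfolding positively_expansive_def by (metis mem_sphere_0)
  show ?thesis
    using \<open>bounded K\<close> \<open>1 < c\<close>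
  proof (rule bounded_expanding_set_trivial)
    fix y assume y: "y \<in> K" "y \<noteq> 0"
    then obtain n where "c \<le> norm ((T ^^ n) (y /\<^sub>R norm y))"
      using c[of "y /\<^sub>R norm y"] by auto
    then have "c * norm y \<le> norm ((T ^^ n) y)"
      using linear_expand_rescale[OF linear_funpow] bounded_clinearD(2)[OF GL_D(1)[OF T]] y by blast
    moreover have "(T ^^ n) y \<in> K"
      using \<open>T ` K \<subseteq> K\<close> y by (induction n) auto
    ultimately show "\<exists>y'\<in>K. c * norm y \<le> norm y'"
      by blast
  qed
qed

text \<open>One argument for both kinds of expansiveness. \<open>P\<close> is the kind of invariance
  that rules out nontrivial bounded sets (equality or inclusion), and \<open>D\<close> is a compact
  set of multipliers that each \<open>l\<close> in \<open>L\<close> preserves in that sense.\<close>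

lemma no_bounded_orbit_imp_bounded_below:
  fixes T :: "'a::complex_normed_vector \<Rightarrow> 'a"
  assumes T: "T \<in> GL" and stable: "structurally_stable T \<or> structurally_stable_rel_GL T"
    and L: "\<And>l. l \<in> L \<Longrightarrow> cmod l \<le> 1"
    and D: "compact D" "1 \<in> D" "D \<subseteq> cball 0 1"
    and trivial: "\<And>K. bounded K \<Longrightarrow> P (T ` K) K \<Longrightarrow> K \<subseteq> {0}"
    and P_refl: "\<And>K. P K K"
    and P_image: "\<And>l (h :: complex \<Rightarrow> 'a). l \<in> L \<Longrightarrow> P (h ` (\<lambda>m. l * m) ` D) (h ` D)"
  obtains \<epsilon> where "0 < \<epsilon>" and "\<And>l x. l \<in> L \<Longrightarrow> \<epsilon> * norm x \<le> norm (T x - l *\<^sub>C x)"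
proof -
  note T_lin = bounded_clinearD(2)[OF GL_D(1)[OF T]]
  obtain \<epsilon> where "0 < \<epsilon>"
    and \<epsilon>: "\<And>x l. norm x = 1 \<Longrightarrow> cmod l \<le> 1 \<Longrightarrow> norm (T x - l *\<^sub>C x) < \<epsilon> \<Longrightarrow>
      \<exists>h. continuous_on UNIV h \<and> inj h \<and> (\<forall>m\<in>cball 0 1. h ((l * m) *\<^sub>C x) = T (h (m *\<^sub>C x)))"
    using stable_imp_conjugate_eigenline[OF T stable] by blast
  have unit: "\<epsilon> \<le> norm (T x - l *\<^sub>C x)" if x: "norm x = 1" and l: "l \<in> L" for x l
  proof (rule ccontr)
    assume "\<not> \<epsilon> \<le> norm (T x - l *\<^sub>C x)"
    then obtain h where h: "continuous_on UNIV h" "inj h"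
      and conj: "\<And>m. m \<in> cball 0 1 \<Longrightarrow> h ((l * m) *\<^sub>C x) = T (h (m *\<^sub>C x))"
      using \<epsilon>[OF x L[OF l]] by fastforce
    \<comment> \<open>The multiplier 0 makes \<open>h 0\<close> a fixed point of \<open>T\<close>,
      hence a bounded invariant singleton.\<close>
    have "T ` {h 0} = {h 0}"
      using conj[of 0] by simp
    then have "h 0 = 0"
      using trivial[of "{h 0}"] P_refl[of "{h 0}"] by simp
    define g where "g m = h (m *\<^sub>C x)" for m
    have "continuous_on D (\<lambda>m. m *\<^sub>C x)"
      by (intro linear_continuous_on bounded_linear_scaleC_left)
    then have "continuous_on D g"
      unfolding g_def by (rule continuous_on_compose2[OF h(1)]) simp
    \<comment> \<open>A homeomorphism may destroy boundedness but not compactness.\<close>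
    then have "bounded (g ` D)"
      using \<open>compact D\<close> by (intro compact_imp_bounded compact_continuous_image)
    moreover have "T ` g ` D = g ` (\<lambda>m. l * m) ` D"
      unfolding image_image using conj D(3) by (intro image_cong) (auto simp: g_def)
    then have "P (T ` g ` D) (g ` D)"
      using P_image[OF l] by simp
    ultimately have "g ` D \<subseteq> {0}"
      by (rule trivial)
    then have "h x = h 0"
      using \<open>1 \<in> D\<close> \<open>h 0 = 0\<close> by (auto simp: g_def scaleC_one)
    then show False
      using injD[OF h(2)] x by fastforce
  qed
  have "\<epsilon> * norm x \<le> norm (T x - l *\<^sub>C x)" if "l \<in> L" for l x
  proof (cases "x = 0")
    case True
    then show ?thesis by (simp add: linear_0[OF T_lin])
  next
    case False
    have "T (x /\<^sub>R norm x) - l *\<^sub>C (x /\<^sub>R norm x) = (T x - l *\<^sub>C x) /\<^sub>R norm x"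
      by (simp add: linear_scale[OF T_lin] scaleC_scaleR_commute scaleR_diff_right)
    then have "norm (T (x /\<^sub>R norm x) - l *\<^sub>C (x /\<^sub>R norm x)) = norm (T x - l *\<^sub>C x) / norm x"
      by (simp add: divide_inverse)
    then show ?thesis
      using unit[of "x /\<^sub>R norm x" l] that False by (simp add: pos_le_divide_eq)
  qed
  then show thesis
    using that \<open>0 < \<epsilon>\<close> by blast
qed

text \<open>A unimodular \<open>l\<close> permutes the circle, with \<open>m / l\<close> as preimage
  of \<open>m\<close>, so the conjugated circle is exactly invariant.\<close>

lemma expansive_imp_bounded_below:
  fixes T :: "'a::complex_normed_vector \<Rightarrow> 'a"
  assumes T: "T \<in> GL" "structurally_stable T \<or> structurally_stable_rel_GL T" and "expansive T"
  obtains \<epsilon> where "0 < \<epsilon>" and "\<And>l x. cmod l = 1 \<Longrightarrow> \<epsilon> * norm x \<le> norm (T x - l *\<^sub>C x)"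
proof (rule no_bounded_orbit_imp_bounded_below[OF T, where L = "sphere 0 1" and D = "sphere 0 1"
      and P = "(=)"])
  fix l :: complex and h :: "complex \<Rightarrow> 'a"
  assume l: "l \<in> sphere 0 1"
  have "(\<lambda>m. l * m) ` sphere 0 1 = sphere 0 1"
  proof (intro equalityI subsetI)
    fix m assume "m \<in> sphere (0::complex) 1"
    then show "m \<in> (\<lambda>m. l * m) ` sphere 0 1"
      using l by (intro image_eqI[of _ _ "m / l"]) (auto simp: norm_divide)
  qed (use l in \<open>auto simp: norm_mult\<close>)
  then show "h ` (\<lambda>m. l * m) ` sphere 0 1 = h ` sphere 0 1"
    by simp
qed (use expansive_no_bounded_orbit[OF T(1) \<open>expansive T\<close>] that in auto)

text \<open>For \<open>cmod l < 1\<close> multiplication by \<open>l\<close> is not onto the disc;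
  the conjugated disc is only forward invariant, which positive expansiveness can handle.\<close>

lemma positively_expansive_imp_bounded_below:
  fixes T :: "'a::complex_normed_vector \<Rightarrow> 'a"
  assumes T: "T \<in> GL" "structurally_stable T \<or> structurally_stable_rel_GL T"
    and "positively_expansive T"
  obtains \<epsilon> where "0 < \<epsilon>" and "\<And>l x. cmod l \<le> 1 \<Longrightarrow> \<epsilon> * norm x \<le> norm (T x - l *\<^sub>C x)"
proof (rule no_bounded_orbit_imp_bounded_below[OF T, where L = "cball 0 1" and D = "cball 0 1"
      and P = "(\<subseteq>)"])
  fix l :: complex and h :: "complex \<Rightarrow> 'a"
  assume "l \<in> cball 0 1"
  then show "h ` (\<lambda>m. l * m) ` cball 0 1 \<subseteq> h ` cball 0 1"
    by (intro image_mono) (auto simp: norm_mult mult_le_one)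
qed (use positively_expansive_no_bounded_orbit[OF T(1) \<open>positively_expansive T\<close>] that in auto)

subsection \<open>Lower bounds on the disc and on the circle\<close>

lemma surj_perturb:
  fixes T :: "'a::cbanach \<Rightarrow> 'a"
  assumes T: "bounded_clinear T" and "0 < \<epsilon>"
    and below: "\<And>x. \<epsilon> * norm x \<le> norm (T x - a *\<^sub>C x)"
    and surj: "surj (\<lambda>x. T x - a *\<^sub>C x)" and close: "cmod (b - a) < \<epsilon>"
  shows "surj (\<lambda>x. T x - b *\<^sub>C x)"
proof -
  define R where "R = inv (\<lambda>x. T x - a *\<^sub>C x)"
  have R: "T (R y) - a *\<^sub>C R y = y" for y
    using surj_f_inv_f[OF surj] by (simp add: R_def)
  have "\<exists>x. T x - b *\<^sub>C x = y" for y
  proof -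
    \<comment> \<open>Fixed points of \<open>F\<close> solve \<open>T x - b *\<^sub>C x = y\<close>.
      The lower bound applied to differences of values makes \<open>F\<close> a contraction with
      factor \<open>cmod (b - a) / \<epsilon>\<close>.\<close>
    define F where "F x = R (y + (b - a) *\<^sub>C x)" for x
    have "dist (F x) (F x') \<le> cmod (b - a) / \<epsilon> * dist x x'" for x x'
    proof -
      have "T (F x - F x') - a *\<^sub>C (F x - F x')
          = (T (F x) - a *\<^sub>C F x) - (T (F x') - a *\<^sub>C F x')"
        by (simp add: linear_diff[OF bounded_clinearD(2)[OF T]] scaleC_diff_right)
      also have "\<dots> = (b - a) *\<^sub>C (x - x')"
        unfolding F_def R by (simp add: scaleC_diff_right)
      finally have "\<epsilon> * norm (F x - F x') \<le> cmod (b - a) * norm (x - x')"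
        using below[of "F x - F x'"] by (simp add: norm_scaleC)
      then show ?thesis
        using \<open>0 < \<epsilon>\<close> by (simp add: dist_norm pos_le_divide_eq mult.commute)
    qed
    moreover have "0 \<le> cmod (b - a) / \<epsilon>" "cmod (b - a) / \<epsilon> < 1"
      using close \<open>0 < \<epsilon>\<close> by simp_all
    ultimately have "\<exists>!x. F x = x"
      by (intro banach_fix_type) auto
    then obtain x where "F x = x"
      by blast
    then have "T x - a *\<^sub>C x = y + (b - a) *\<^sub>C x"
      using R[of "y + (b - a) *\<^sub>C x"] by (simp add: F_def)
    then have "T x - b *\<^sub>C x = y"
      by (simp add: scaleC_diff_left diff_eq_eq add.assoc)
    then show ?thesis by blast
  qed
  then show ?thesis
    by (auto simp: surj_def) metis
qed

lemma bounded_below_disc_imp_hyperbolic: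
  fixes T :: "'a::cbanach \<Rightarrow> 'a"
  assumes T: "T \<in> GL" and "0 < \<epsilon>"
    and below: "\<And>l x. cmod l \<le> 1 \<Longrightarrow> \<epsilon> * norm x \<le> norm (T x - l *\<^sub>C x)"
  shows "hyperbolic T"
proof -
  note T_lin = GL_D(1)[OF T]
  have "(\<lambda>x. T x - l *\<^sub>C x) \<in> GL" if l: "cmod l = 1" for l
  proof -
    obtain N where N: "inverse (real (Suc N)) < \<epsilon>"
      using reals_Archimedean[OF \<open>0 < \<epsilon>\<close>] by blast
    \<comment> \<open>The radius from 0 to \<open>l\<close> in steps shorter than
      \<open>\<epsilon>\<close>: it starts at \<open>T\<close> itself and stays in the disc, where
      the same lower bound holds throughout.\<close>
    define a where "a k = (of_real (real k / real (Suc N)) * l :: complex)" for k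
    have a_le: "cmod (a k) \<le> 1" if "k \<le> Suc N" for k
      using that l by (simp add: a_def norm_mult norm_divide del: of_nat_Suc)
    have a_diff: "cmod (a (Suc k) - a k) < \<epsilon>" for k
    proof -
      have "real (Suc k) / real (Suc N) - real k / real (Suc N) = inverse (real (Suc N))"
        by (simp add: divide_inverse algebra_simps)
      then have "a (Suc k) - a k = of_real (inverse (real (Suc N))) * l"
        unfolding a_def by (metis left_diff_distrib of_real_diff)
      then have "cmod (a (Suc k) - a k) = inverse (real (Suc N))"
        using l by (simp add: norm_mult norm_inverse del: of_nat_Suc)
      then show ?thesis using N by simp
    qed
    have "surj (\<lambda>x. T x - a k *\<^sub>C x)" if "k \<le> Suc N" for k
      using that
    proof (induction k)
      case 0
      then show ?case
        using GL_D(3)[OF T] by (simp add: a_def bij_is_surj)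
    next
      case (Suc k)
      then show ?case
        using surj_perturb[OF T_lin \<open>0 < \<epsilon>\<close> below[OF a_le] _ a_diff] by simp
    qed
    moreover have "a (Suc N) = l"
      by (simp add: a_def del: of_nat_Suc)
    ultimately have "surj (\<lambda>x. T x - l *\<^sub>C x)"
      by (metis order_refl)
    have "bounded_clinear (\<lambda>x. T x - l *\<^sub>C x)"
      using T_lin by (simp add: bounded_clinear_def bounded_linear_sub bounded_linear_scaleC_right
          scaleC_diff_right scaleC_scaleC mult.commute)
    then show ?thesis
      using \<open>surj (\<lambda>x. T x - l *\<^sub>C x)\<close>
      by (rule bounded_below_surj_in_GL[OF _ _ \<open>0 < \<epsilon>\<close>]) (simp add: below l)
  qed
  then show ?thesis
    by (auto simp: hyperbolic_def spectrum_def)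
qed

section \<open>Averaging over roots of unity\<close>

lemma sum_powers_unit_root:
  fixes m N :: nat
  assumes "0 < m" "m < 2 * N"
  shows "(\<Sum>j<N. cis (2 * pi * real j / real N) ^ m) = (if m = N then of_nat N else 0)"
proof -
  define z where "z = cis (2 * pi * real m / real N)"
  have "0 < N" using assms by simp
  \<comment> \<open>Exchanging the two exponents turns the sum into a geometric series in
    \<open>z\<close>.\<close>
  have pow: "cis (2 * pi * real j / real N) ^ m = z ^ j" for j
    by (simp add: z_def Complex.DeMoivre mult.commute mult.left_commute)
  have "z ^ N = 1"
    using \<open>0 < N\<close> cis_multiple_2pi[of "real m"] by (simp add: z_def Complex.DeMoivre)
  show ?thesis
  proof (cases "m = N")
    case True
    then have "z = 1"
      using \<open>0 < N\<close> by (simp add: z_def)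
    then have "(\<Sum>j<N. cis (2 * pi * real j / real N) ^ m) = of_nat N"
      unfolding pow by simp
    then show ?thesis
      using True by simp
  next
    case False
    have "z \<noteq> 1"
    proof
      assume "z = 1"
      then have "cos (2 * pi * (real m / real N)) = 1"
        by (simp add: z_def complex_eq_iff)
      then obtain n :: int where "2 * pi * (real m / real N) = n * 2 * pi"
        by (auto simp: cos_one_2pi_int)
      \<comment> \<open>Now \<open>m\<close> is a multiple of \<open>N\<close> strictly between 0
        and \<open>2 * N\<close>, so it equals \<open>N\<close>.\<close>
      then have "real m = n * real N"
        using \<open>0 < N\<close> by (simp add: field_simps)
      then have n: "int m = n * int N"
        by (metis of_int_eq_iff of_int_mult of_int_of_nat_eq)
      have "0 < n"
        using n assms(1) by (metis of_nat_0_less_iff of_nat_0_le_iff zero_less_mult_pos2 not_less mult_nonpos_nonneg)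
      moreover have "n < 2"
        using n assms(2) \<open>0 < N\<close> by (metis mult_less_cancel_right_pos of_nat_0_less_iff of_nat_less_iff of_nat_mult of_nat_numeral)
      ultimately have "n = 1"
        by simp
      then show False
        using n False by simp
    qed
    then show ?thesis
      using False \<open>z ^ N = 1\<close> by (simp add: pow sum_gp_strict)
  qed
qed

lemma bounded_clinear_funpow:
  fixes T :: "'a::complex_normed_vector \<Rightarrow> 'a"
  shows "bounded_clinear T \<Longrightarrow> bounded_clinear (T ^^ n)"
proof (induction n)
  case 0
  then show ?case by (simp add: bounded_clinear_def id_def bounded_linear_ident)
next
  case (Suc n)
  then show ?case
    using bounded_clinear_compose[of T "T ^^ n"] by (simp add: o_def)
qed

text \<open>With \<open>G\<^sub>w = (\<Sum>i<N. w\<^sup>i T\<^sup>i)\<close> and \<open>w\<^sup>N = 1\<close> one has \<open>(w T - 1) G\<^sub>w = T\<^sup>N - 1\<close>, so the lower bound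
  for \<open>T - w\<^sup>-\<^sup>1\<close> controls \<open>G\<^sub>w\<^sup>2\<close> by \<open>(T\<^sup>N - 1)\<^sup>2\<close>, with a constant independent of \<open>N\<close>. Averaging
  \<open>w G\<^sub>w\<^sup>2\<close> over the \<open>N\<close>-th roots of unity leaves \<open>N T\<^sup>N\<^sup>-\<^sup>1\<close>, which gains the factor \<open>N\<close>.\<close>

lemma bounded_below_circle_imp_power_estimate:
  fixes T :: "'a::complex_normed_vector \<Rightarrow> 'a"
  assumes T: "bounded_clinear T" and "0 < \<epsilon>"
    and below: "\<And>l x. cmod l = 1 \<Longrightarrow> \<epsilon> * norm x \<le> norm (T x - l *\<^sub>C x)"
    and "0 < N"
  shows "\<epsilon>\<^sup>2 * (real N * norm ((T ^^ (N - 1)) z))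
    \<le> norm ((T ^^ N) ((T ^^ N) z)) + 2 * norm ((T ^^ N) z) + norm z"
proof -
  \<comment> \<open>The triangle-inequality bound for (T^N - 1)^2 z, whose coefficients have
    absolute values 1, 2, 1.\<close>
  define B where "B = norm ((T ^^ N) ((T ^^ N) z)) + 2 * norm ((T ^^ N) z) + norm z"
  note T_lin = bounded_clinearD(2)[OF T] and T_cscale = bounded_clinearD(3)[OF T]
  note pow_lin = linear_funpow[OF T_lin]
  note pow_cscale = bounded_clinearD(3)[OF bounded_clinear_funpow[OF T]]
  note cscale_lin = bounded_linear.linear[OF bounded_linear_scaleC_right]
  define G where "G w x = (\<Sum>i<N. w ^ i *\<^sub>C (T ^^ i) x)" for w x
  have G_below: "\<epsilon> * norm (G w x) \<le> norm ((T ^^ N) x - x)" if w: "cmod w = 1" "w ^ N = 1" for w x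
  proof -
    have "w \<noteq> 0" using w by auto
    have "w *\<^sub>C T (G w x) - G w x = (\<Sum>i<N. w ^ Suc i *\<^sub>C (T ^^ Suc i) x - w ^ i *\<^sub>C (T ^^ i) x)"
      by (simp add: G_def linear_sum[OF T_lin] linear_sum[OF cscale_lin] T_cscale scaleC_scaleC
          sum_subtractf)
    also have "\<dots> = (T ^^ N) x - x"
      using sum_lessThan_telescope[of "\<lambda>i. w ^ i *\<^sub>C (T ^^ i) x" N] by (simp add: w scaleC_one)
    finally have "w *\<^sub>C T (G w x) - G w x = (T ^^ N) x - x" .
    moreover have "w *\<^sub>C T (G w x) - G w x = w *\<^sub>C (T (G w x) - inverse w *\<^sub>C G w x)"
      using \<open>w \<noteq> 0\<close> by (simp add: scaleC_diff_right scaleC_scaleC scaleC_one)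
    ultimately have "norm ((T ^^ N) x - x) = norm (T (G w x) - inverse w *\<^sub>C G w x)"
      using w by (metis norm_scaleC mult_1)
    then show ?thesis
      using below[of "inverse w" "G w x"] w by (simp add: norm_inverse)
  qed
  have GG: "\<epsilon>\<^sup>2 * norm (G w (G w z)) \<le> B" if w: "cmod w = 1" "w ^ N = 1" for w
  proof -
    \<comment> \<open>Commutation with the powers of \<open>T\<close> lets \<open>G_below\<close> be
      used twice, at \<open>G w z\<close> and at \<open>(T ^^ N) z - z\<close>.\<close>
    have pow_G: "(T ^^ k) (G w x) = G w ((T ^^ k) x)" for k x
      by (simp add: G_def linear_sum[OF pow_lin] pow_cscale flip: funpow_add[THEN fun_cong, unfolded comp_apply])
         (simp add: add.commute)
    have "G w (x - y) = G w x - G w y" for x y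
      by (simp add: G_def linear_diff[OF pow_lin] scaleC_diff_right sum_subtractf)
    then have "(T ^^ N) (G w z) - G w z = G w ((T ^^ N) z - z)"
      by (simp add: pow_G)
    then have "\<epsilon> * norm (G w (G w z)) \<le> norm (G w ((T ^^ N) z - z))"
      using G_below[OF w, of "G w z"] by simp
    then have "\<epsilon> * (\<epsilon> * norm (G w (G w z))) \<le> \<epsilon> * norm (G w ((T ^^ N) z - z))"
      using \<open>0 < \<epsilon>\<close> by simp
    also have "\<dots> \<le> norm ((T ^^ N) ((T ^^ N) z - z) - ((T ^^ N) z - z))"
      by (rule G_below[OF w])
    also have "\<dots> = norm ((T ^^ N) ((T ^^ N) z) - (T ^^ N) z - (T ^^ N) z + z)"
      by (simp add: linear_diff[OF pow_lin] diff_diff_eq2 diff_add_eq)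
    also have "\<dots> \<le> B"
      unfolding B_def
      using norm_triangle_ineq[of "(T ^^ N) ((T ^^ N) z) - (T ^^ N) z - (T ^^ N) z" z]
        norm_triangle_ineq4[of "(T ^^ N) ((T ^^ N) z) - (T ^^ N) z" "(T ^^ N) z"]
        norm_triangle_ineq4[of "(T ^^ N) ((T ^^ N) z)" "(T ^^ N) z"]
      by linarith
    finally show ?thesis
      by (simp add: power2_eq_square mult.assoc)
  qed
  define w where "w j = cis (2 * pi * real j / real N)" for j
  have w: "cmod (w j) = 1" "w j ^ N = 1" for j
    using \<open>0 < N\<close> cis_multiple_2pi[of "real j"] by (simp_all add: w_def Complex.DeMoivre)
  have "(\<Sum>j<N. w j *\<^sub>C G (w j) (G (w j) z))
      = (\<Sum>j<N. \<Sum>i<N. \<Sum>k<N. w j ^ Suc (i + k) *\<^sub>C (T ^^ (i + k)) z)"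
    by (simp add: G_def linear_sum[OF pow_lin] linear_sum[OF cscale_lin] pow_cscale scaleC_scaleC
        funpow_add power_add mult.assoc)
  also have "\<dots> = (\<Sum>i<N. \<Sum>j<N. \<Sum>k<N. w j ^ Suc (i + k) *\<^sub>C (T ^^ (i + k)) z)"
    by (rule sum.swap)
  also have "\<dots> = (\<Sum>i<N. \<Sum>k<N. \<Sum>j<N. w j ^ Suc (i + k) *\<^sub>C (T ^^ (i + k)) z)"
    by (intro sum.cong refl sum.swap)
  also have "\<dots> = (\<Sum>i<N. \<Sum>k<N. (\<Sum>j<N. w j ^ Suc (i + k)) *\<^sub>C (T ^^ (i + k)) z)"
    by (simp only: linear_sum[OF bounded_linear.linear[OF bounded_linear_scaleC_left]])
  \<comment> \<open>The exponent \<open>Suc (i + k)\<close> lies between 1 and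
    \<open>2 * N - 1\<close>, so only \<open>i + k = N - 1\<close> survives, with exactly one
    \<open>k\<close> for each \<open>i\<close>.\<close>
  also have "\<dots> = (\<Sum>i<N. \<Sum>k<N. if k = N - 1 - i then of_nat N *\<^sub>C (T ^^ (N - 1)) z else 0)"
  proof (intro sum.cong refl)
    fix i k assume "i \<in> {..<N}" "k \<in> {..<N}"
    then show "(\<Sum>j<N. w j ^ Suc (i + k)) *\<^sub>C (T ^^ (i + k)) z
        = (if k = N - 1 - i then of_nat N *\<^sub>C (T ^^ (N - 1)) z else 0)"
      using sum_powers_unit_root[of "Suc (i + k)" N] by (auto simp: w_def)
  qed
  also have "\<dots> = (\<Sum>i<N. of_nat N *\<^sub>C (T ^^ (N - 1)) z)"
    using \<open>0 < N\<close> by (intro sum.cong refl) (simp add: sum.delta)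
  also have "\<dots> = real N *\<^sub>R (of_nat N *\<^sub>C (T ^^ (N - 1)) z)"
    by (simp add: sum_constant_scaleR)
  finally have avg: "(\<Sum>j<N. w j *\<^sub>C G (w j) (G (w j) z))
      = real N *\<^sub>R (of_nat N *\<^sub>C (T ^^ (N - 1)) z)" .
  \<comment> \<open>The average carries the factor N^2, while the triangle inequality costs only
    \<open>N\<close> summands.\<close>
  have "real N * (real N * norm ((T ^^ (N - 1)) z)) = norm (\<Sum>j<N. w j *\<^sub>C G (w j) (G (w j) z))"
    by (simp add: avg norm_scaleC)
  also have "\<dots> \<le> (\<Sum>j<N. norm (G (w j) (G (w j) z)))"
    by (intro sum_norm_le) (simp add: norm_scaleC w)
  finally have "\<epsilon>\<^sup>2 * (real N * (real N * norm ((T ^^ (N - 1)) z)))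
      \<le> \<epsilon>\<^sup>2 * (\<Sum>j<N. norm (G (w j) (G (w j) z)))"
    by (rule mult_left_mono) simp
  also have "\<dots> = (\<Sum>j<N. \<epsilon>\<^sup>2 * norm (G (w j) (G (w j) z)))"
    by (rule sum_distrib_left)
  also have "\<dots> \<le> (\<Sum>j<N. B)"
    by (intro sum_mono GG w)
  finally have "real N * (\<epsilon>\<^sup>2 * (real N * norm ((T ^^ (N - 1)) z))) \<le> real N * B"
    by (simp add: mult.left_commute)
  then show ?thesis
    using \<open>0 < N\<close> by (simp add: B_def)
qed

text \<open>The power estimate is read at \<open>z\<close>, the \<open>N\<close>-th preimage of a
  unit vector \<open>x\<close>. Its left side grows linearly in \<open>N\<close>, so the norms of
  the forward and backward iterates of \<open>x\<close> cannot both stay below 2.\<close>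

lemma bounded_below_circle_imp_uniformly_expansive:
  fixes T :: "'a::complex_normed_vector \<Rightarrow> 'a"
  assumes T: "T \<in> GL" and "0 < \<epsilon>"
    and below: "\<And>l x. cmod l = 1 \<Longrightarrow> \<epsilon> * norm x \<le> norm (T x - l *\<^sub>C x)"
  shows "uniformly_expansive T"
proof -
  obtain C where "0 < C" and C: "\<And>y. norm (T y) \<le> norm y * C"
    using bounded_linear.pos_bounded[OF bounded_clinearD(1)[OF GL_D(1)[OF T]]] by blast
  \<comment> \<open>If both iterates had norm below 2, the right side would be below 2 + 2 + 2 = 6;
    the left side is at least \<open>\<epsilon>\<^sup>2 * real N / C\<close>, since \<open>x\<close>
    is the image under \<open>T\<close> of the vector \<open>(T ^^ (N - 1)) z\<close>.\<close>
  obtain N :: nat where N: "6 * C / \<epsilon>\<^sup>2 < real N"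
    using reals_Archimedean2 by blast
  moreover have "0 < 6 * C / \<epsilon>\<^sup>2"
    using \<open>0 < C\<close> \<open>0 < \<epsilon>\<close> by simp
  ultimately have "0 < N"
    by (metis of_nat_0_less_iff order_less_trans)
  have "2 \<le> norm ((T ^^ N) x) \<or> 2 \<le> norm ((inv T ^^ N) x)" if x: "norm x = 1" for x
  proof (rule ccontr)
    assume "\<not> ?thesis"
    then have less: "norm ((T ^^ N) x) < 2" "norm ((inv T ^^ N) x) < 2"
      by auto
    define z where "z = (inv T ^^ N) x"
    have z: "(T ^^ N) z = x"
      unfolding z_def using GL_D(4)[OF T]
      by (metis fn_o_inv_fn_is_id GL_D(3)[OF T] comp_apply)
    have "\<epsilon>\<^sup>2 * (real N * norm ((T ^^ (N - 1)) z)) < 6"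
      using bounded_below_circle_imp_power_estimate[OF GL_D(1)[OF T] \<open>0 < \<epsilon>\<close> below \<open>0 < N\<close>, of z]
        less x by (simp add: z) (simp add: z_def)
    moreover have "(T ^^ N) z = T ((T ^^ (N - 1)) z)"
      using \<open>0 < N\<close> by (cases N) auto
    then have "1 \<le> norm ((T ^^ (N - 1)) z) * C"
      using C[of "(T ^^ (N - 1)) z"] x by (simp add: z)
    then have "\<epsilon>\<^sup>2 * real N * 1 \<le> \<epsilon>\<^sup>2 * real N * (norm ((T ^^ (N - 1)) z) * C)"
      by (intro mult_left_mono) auto
    moreover have "6 * C < \<epsilon>\<^sup>2 * real N"
      using N \<open>0 < \<epsilon>\<close> by (simp add: pos_divide_less_eq mult.commute)
    ultimately have "6 * C < (\<epsilon>\<^sup>2 * (real N * norm ((T ^^ (N - 1)) z))) * C"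
      by (simp add: mult.assoc)
    then show False
      using \<open>\<epsilon>\<^sup>2 * (real N * norm ((T ^^ (N - 1)) z)) < 6\<close> \<open>0 < C\<close>
      by (simp add: mult_less_cancel_right_pos)
  qed
  then have "\<forall>x\<in>sphere 0 1. 2 \<le> norm (int_iterate T (int N) x) \<or> 2 \<le> norm (int_iterate T (- int N) x)"
    using \<open>0 < N\<close> by (auto simp: int_iterate_def)
  then show ?thesis
    unfolding uniformly_expansive_def using \<open>0 < N\<close>
    by (intro exI[of _ 2] conjI exI[of _ N]) auto
qed

theorem theorem6:
  fixes T :: "'a::cbanach \<Rightarrow> 'a"
  assumes "T \<in> GL"
    and "structurally_stable T \<or> structurally_stable_rel_GL T"
  shows "(expansive T \<longrightarrow> uniformly_expansive T) \<and>
         (positively_expansive T \<longrightarrow> hyperbolic T)"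
proof (intro conjI impI)
  assume "expansive T"
  then obtain \<epsilon> where "0 < \<epsilon>" "\<And>l x. cmod l = 1 \<Longrightarrow> \<epsilon> * norm x \<le> norm (T x - l *\<^sub>C x)"
    using expansive_imp_bounded_below[OF assms] by blast
  then show "uniformly_expansive T"
    by (rule bounded_below_circle_imp_uniformly_expansive[OF assms(1)])
next
  assume "positively_expansive T"
  then obtain \<epsilon> where "0 < \<epsilon>" "\<And>l x. cmod l \<le> 1 \<Longrightarrow> \<epsilon> * norm x \<le> norm (T x - l *\<^sub>C x)"
    using positively_expansive_imp_bounded_below[OF assms] by blast
  then show "hyperbolic T"
    by (rule bounded_below_disc_imp_hyperbolic[OF assms(1)])
qed

end
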